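(* Let $\mathbf H$ be either $\mathbf Z$ or $\mathbf N$, and let $X\subseteq \mathbf H$. Then the following are equivalent: (a) $X$ is small; (b) $\mathfrak b^\ast_{\mathbf H}(X)=0$; (c) $\mathfrak b^\ast_{\mathbf Z}(X)=0$.
   Context: $\mathbf N=\{0,1,2,\dots\}$, $\mathbf N^+=\mathbf N\setminus\{0\}$. For $X\subseteq\mathbf H$, $k\in\mathbf N^+$, $h\in\mathbf N$ write $k\cdot X+h:=\{kx+h:x\in X\}$. An upper quasi-density on $\mathbf H$ is a function $\mu^\ast:\mathcal P(\mathbf H)\to\mathbf R$ such that for all $X,Y\subseteq\mathbf H$, $k\in\mathbf N^+$, $h\in\mathbf N$: $\mu^\ast(X)\le 1$, $\mu^\ast(\mathbf H)=1$, $\mu^\ast(X\cup Y)\le\mu^\ast(X)+\mu^\ast(Y)$, $\mu^\ast(k\cdot X)=\frac1k\mu^\ast(X)$, and $\mu^\ast(X+h)=\mu^\ast(X)$. A set $X\subseteq\mathbf H$ is small if $\mu^\ast(X)=0$ for every upper quasi-density $\mu^\ast$ on $\mathbf H$. An arithmetic progression of $\mathbf H$ is a set $k\cdot\mathbf H+h$ with $k\in\mathbf N^+$, $h\in\mathbf N$; $\mathscr A_{\mathbf H}$ is the family of finite unions of arithmetic progressions of $\mathbf H$. The upper asymptotic density on $\mathbf H$ is $\mathsf d^\ast_{\mathbf H}(X)=\limsup_{n\to\infty}|X\cap\{1,\dots,n\}|/n$, and the upper Buck density on $\mathbf H$ is $\mathfrak b^\ast_{\mathbf H}(X)=\inf\{\mathsf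 d^\ast_{\mathbf H}(A): A\in\mathscr A_{\mathbf H},\ X\subseteq A\}$ for $X\subseteq\mathbf H$ (so $\mathfrak b^\ast_{\mathbf Z}$ is defined on subsets of $\mathbf Z$, and in (c) $X$ is regarded as a subset of $\mathbf Z$). *)

theory Defs
  imports "HOL-Library.Extended_Real" "HOL-Library.Liminf_Limsup"
begin

text \<open>
  The ambient set \<open>H\<close> is a subset of \<^typ>\<open>int\<close>: either \<open>UNIV\<close> (the integers) or
  \<open>\<nat> :: int set\<close> (the nonnegative integers, including 0). Thus subsets of the naturals are
  literally subsets of the integers.
\<close>

definition dilate_shift :: "nat \<Rightarrow> int set \<Rightarrow> nat \<Rightarrow> int set" where
  "dilate_shift k X h = (\<lambda>x. int k * x + int h) ` X"

text \<open>
  A function on the powerset of \<open>H\<close> is represented by a total function on \<^typ>\<open>int set\<close>, of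
  which only the values on subsets of \<open>H\<close> matter.
\<close>

definition upper_quasi_density :: "int set \<Rightarrow> (int set \<Rightarrow> real) \<Rightarrow> bool" where
  "upper_quasi_density H \<mu> \<longleftrightarrow>
     (\<forall>X. X \<subseteq> H \<longrightarrow> \<mu> X \<le> 1) \<and>
     \<mu> H = 1 \<and>
     (\<forall>X Y. X \<subseteq> H \<longrightarrow> Y \<subseteq> H \<longrightarrow> \<mu> (X \<union> Y) \<le> \<mu> X + \<mu> Y) \<and>
     (\<forall>X k. X \<subseteq> H \<longrightarrow> k > 0 \<longrightarrow> \<mu> (dilate_shift k X 0) = 1 / real k * \<mu> X) \<and>
     (\<forall>X h. X \<subseteq> H \<longrightarrow> \<mu> (dilate_shift 1 X h) = \<mu> X)"

definition small :: "int set \<Rightarrow> int set \<Rightarrow> bool" where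
  "small H X \<longleftrightarrow> X \<subseteq> H \<and> (\<forall>\<mu>. upper_quasi_density H \<mu> \<longrightarrow> \<mu> X = 0)"

definition arith_progressions :: "int set \<Rightarrow> int set set" where
  "arith_progressions H = {dilate_shift k H h | k h. k > 0}"

definition finite_AP_unions :: "int set \<Rightarrow> int set set" where
  "finite_AP_unions H = {\<Union>\<F> | \<F>. finite \<F> \<and> \<F> \<subseteq> arith_progressions H}"

text \<open>
  Only the positive elements of \<open>X\<close> are counted, also when \<open>X\<close> has negative elements, so the
  defining formula is the same for both choices of \<open>H\<close>. The ratios lie in \<open>[0, 1]\<close> (the term at
  \<open>n = 0\<close> is 0), hence the extended-real limit superior is finite and \<open>real_of_ereal\<close> is harmless.
\<close>

definition upper_asymptotic_density :: "int set \<Rightarrow> real" where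
  "upper_asymptotic_density X =
     real_of_ereal (limsup (\<lambda>n. ereal (real (card (X \<inter> {1..int n})) / real n)))"

text \<open>
  For \<open>X \<subseteq> H\<close> the infimum is over a nonempty set (\<open>H\<close> is itself an arithmetic progression) that is
  bounded below by 0.
\<close>

definition upper_Buck_density :: "int set \<Rightarrow> int set \<Rightarrow> real" where
  "upper_Buck_density H X =
     Inf {upper_asymptotic_density A | A. A \<in> finite_AP_unions H \<and> X \<subseteq> A}"

end

theory Submission
  imports Defs
begin

text \<open>
  Let \<open>r K X\<close> be the number of residue classes mod \<open>K\<close> met by \<open>X\<close>. A finite union \<open>A\<close> of
  progressions is closed under adding some \<open>K > 0\<close>, so its upper asymptotic density is
  \<open>r K A / K\<close>; hence the upper Buck density of \<open>X\<close> is the infimum of \<open>r K X / K\<close> over \<open>K\<close>,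
  whichever \<open>H\<close> is used, and (b) and (c) coincide. This infimum is an upper quasi-density, so (a)
  implies (b). Conversely, upper quasi-densities need not be monotone, but cutting \<open>X\<close> itself into
  its residue classes, each of the form \<open>K \<cdot> Y + h\<close> with \<open>Y \<subseteq> H\<close>, gives
  \<open>\<mu> X \<le> r K X / K\<close> for every upper quasi-density \<open>\<mu>\<close>.
\<close>

section \<open>Residue classes met by a set\<close>

definition residue_count :: "nat \<Rightarrow> int set \<Rightarrow> nat" where
  "residue_count K X = card ((\<lambda>x. x mod int K) ` X)"

text \<open>The value \<open>K = 0\<close> must be excluded: division by zero yields 0, which would
  force the infimum to vanish.\<close>

definition residue_density :: "int set \<Rightarrow> real" where
  "residue_density X = (INF K\<in>{0<..}. real (residue_count K X) / real K)"

lemma finite_residues: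
  assumes "K > 0"
  shows "finite ((\<lambda>x. x mod int K) ` X)"
  by (rule finite_subset[of _ "{0..<int K}"]) (use assms in auto)

lemma residue_count_mono:
  assumes "K > 0" "X \<subseteq> Y"
  shows "residue_count K X \<le> residue_count K Y"
  unfolding residue_count_def
  by (intro card_mono finite_residues image_mono) (use assms in auto)

lemma residue_count_Un:
  "residue_count K (X \<union> Y) \<le> residue_count K X + residue_count K Y"
  unfolding residue_count_def image_Un by (rule card_Un_le)

text \<open>Each class mod \<open>K\<close> splits into \<open>L\<close> classes mod
  \<open>K * L\<close>: a remainder mod \<open>K * L\<close> is determined by its own remainder mod
  \<open>K\<close> and its quotient by \<open>K\<close>, which lies in
  \<open>{0..<int L}\<close>.\<close>

lemma residue_count_mult:
  assumes "K > 0" "L > 0"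
  shows "residue_count (K * L) X \<le> residue_count K X * L"
proof -
  let ?f = "\<lambda>x. (x mod int K, x div int K)"
  let ?S = "(\<lambda>x. x mod int (K * L)) ` X"
  have "inj_on ?f ?S"
    by (rule inj_onI) (metis Pair_inject mult_div_mod_eq)
  moreover have "?f ` ?S \<subseteq> ((\<lambda>x. x mod int K) ` X) \<times> {0..<int L}"
  proof (clarsimp, intro conjI)
    fix x assume "x \<in> X"
    have "x mod (int K * int L) mod int K = x mod int K"
      by (simp add: mod_mod_cancel)
    then show "x mod (int K * int L) mod int K \<in> (\<lambda>x. x mod int K) ` X"
      using \<open>x \<in> X\<close> by simp
    have "x mod (int K * int L) \<ge> 0" "x mod (int K * int L) < int K * int L"
      using assms by simp_all
    moreover have "int K * (x mod (int K * int L) div int K) \<le> x mod (int K * int L)"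
      using assms by (simp add: mult_div_mod_eq minus_mod_eq_mult_div[symmetric])
    ultimately have "int K * (x mod (int K * int L) div int K) < int K * int L"
      by linarith
    then show "x mod (int K * int L) div int K < int L"
      using assms by simp
    show "0 \<le> x mod (int K * int L) div int K"
      using assms \<open>x mod (int K * int L) \<ge> 0\<close> by (simp add: pos_imp_zdiv_nonneg_iff)
  qed
  ultimately have "card ?S \<le> card (((\<lambda>x. x mod int K) ` X) \<times> {0..<int L})"
    using finite_residues[OF assms(1)] by (intro card_inj_on_le) auto
  then show ?thesis
    by (simp add: residue_count_def card_cartesian_product)
qed

text \<open>Passing to a multiple of the modulus never raises the ratio, so ratios at different
  moduli can be compared at a common multiple.\<close>

lemma residue_ratio_mult:
  assumes "K > 0" "L > 0"
  shows "real (residue_count (K * L) X) / real (K * L) \<le> real (residue_count K X) / real K"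
proof -
  have "real (residue_count (K * L) X) \<le> real (residue_count K X) * real L"
    using residue_count_mult[OF assms, of X] by (metis of_nat_le_iff of_nat_mult)
  then show ?thesis
    using assms by (simp add: field_simps)
qed

text \<open>Since \<open>k * x mod (k * K) = k * (x mod K)\<close>, the residues are merely scaled
  by \<open>k\<close>, which is injective.\<close>

lemma residue_count_dilate:
  assumes "k > 0"
  shows "residue_count (k * K) (dilate_shift k X 0) = residue_count K X"
proof -
  have "(\<lambda>x. x mod int (k * K)) ` dilate_shift k X 0 = (*) (int k) ` (\<lambda>x. x mod int K) ` X"
    by (simp add: dilate_shift_def image_image)
  then show ?thesis
    using assms by (simp add: residue_count_def card_image inj_on_def)
qed

lemma residue_count_shift:
  "residue_count K (dilate_shift 1 X h) = residue_count K X"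
proof -
  let ?R = "(\<lambda>x. x mod int K) ` X"
  let ?f = "\<lambda>y. (y + int h) mod int K"
  have "inj_on ?f ?R"
  proof (rule inj_onI)
    fix r s
    assume "r \<in> ?R" "s \<in> ?R" and eq: "?f r = ?f s"
    have "(r + int h - int h) mod int K = (s + int h - int h) mod int K"
      by (rule mod_diff_cong[OF eq refl])
    then have "r mod int K = s mod int K"
      by simp
    moreover have "r mod int K = r" "s mod int K = s"
      using \<open>r \<in> ?R\<close> \<open>s \<in> ?R\<close> by auto
    ultimately show "r = s"
      by simp
  qed
  moreover have "(\<lambda>x. x mod int K) ` dilate_shift 1 X h = ?f ` ?R"
    by (simp add: dilate_shift_def image_image mod_add_left_eq)
  ultimately show ?thesis
    by (simp add: residue_count_def card_image)
qed

section \<open>The infimum of the residue ratios as an upper quasi-density\<close>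

lemma bdd_below_residue_ratio:
  "bdd_below ((\<lambda>K. real (residue_count K X) / real K) ` {0<..})"
  by (rule bdd_belowI2[of _ 0]) simp

lemma residue_density_le:
  assumes "K > 0"
  shows "residue_density X \<le> real (residue_count K X) / real K"
  unfolding residue_density_def
  by (rule cINF_lower[OF bdd_below_residue_ratio]) (use assms in simp)

lemma residue_density_ge:
  assumes "\<And>K. K > 0 \<Longrightarrow> c \<le> real (residue_count K X) / real K"
  shows "c \<le> residue_density X"
  unfolding residue_density_def by (rule cINF_greatest) (use assms in auto)

lemma residue_density_Un:
  "residue_density (X \<union> Y) \<le> residue_density X + residue_density Y"
proof -
  have bound: "residue_density (X \<union> Y)
      \<le> real (residue_count K X) / real K + real (residue_count L Y) / real L"
    if "K > 0" "L > 0" for K L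
  proof -
    have "residue_density (X \<union> Y) \<le> real (residue_count (K * L) (X \<union> Y)) / real (K * L)"
      using that by (intro residue_density_le) simp
    also have "\<dots> \<le> real (residue_count (K * L) X + residue_count (K * L) Y) / real (K * L)"
      by (intro divide_right_mono of_nat_mono residue_count_Un) simp
    \<comment> \<open>The second product is written \<open>L * K\<close> so that refinement can be
      undone towards \<open>L\<close> for \<open>Y\<close> and towards \<open>K\<close> for
      \<open>X\<close>.\<close>
    also have "\<dots> = real (residue_count (K * L) X) / real (K * L)
        + real (residue_count (L * K) Y) / real (L * K)"
      by (simp add: add_divide_distrib mult.commute)
    also have "\<dots> \<le> real (residue_count K X) / real K + real (residue_count L Y) / real L"
      using that by (intro add_mono residue_ratio_mult)
    finally show ?thesis .
  qed
  \<comment> \<open>The two infima are taken one after the other: over \<open>K\<close> with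
    \<open>L\<close> fixed, then over \<open>L\<close>.\<close>
  have "residue_density (X \<union> Y) - real (residue_count L Y) / real L \<le> residue_density X"
    if "L > 0" for L
    by (rule residue_density_ge) (use bound that in \<open>simp add: algebra_simps\<close>)
  then have "residue_density (X \<union> Y) - residue_density X \<le> residue_density Y"
    by (intro residue_density_ge) (simp add: algebra_simps)
  then show ?thesis
    by simp
qed

lemma residue_density_dilate:
  assumes "k > 0"
  shows "residue_density (dilate_shift k X 0) = 1 / real k * residue_density X"
proof (rule antisym)
  have "real k * residue_density (dilate_shift k X 0) \<le> residue_density X"
  proof (rule residue_density_ge)
    fix K :: nat assume "K > 0"
    then have "residue_density (dilate_shift k X 0)
        \<le> real (residue_count (k * K) (dilate_shift k X 0)) / real (k * K)"
      using assms by (intro residue_density_le) simp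
    then show "real k * residue_density (dilate_shift k X 0) \<le> real (residue_count K X) / real K"
      using assms \<open>K > 0\<close> by (simp only: residue_count_dilate) (simp add: field_simps)
  qed
  then show "residue_density (dilate_shift k X 0) \<le> 1 / real k * residue_density X"
    using assms by (simp add: field_simps)
  show "1 / real k * residue_density X \<le> residue_density (dilate_shift k X 0)"
  proof (rule residue_density_ge)
    \<comment> \<open>An arbitrary modulus \<open>K\<close> for the dilate need not be divisible by
      \<open>k\<close>; refining it to \<open>K * k\<close> lowers the ratio at most and makes the
      count computable.\<close>
    fix K :: nat assume "K > 0"
    have "1 / real k * residue_density X \<le> 1 / real k * (real (residue_count K X) / real K)"
      using \<open>K > 0\<close> by (intro mult_left_mono residue_density_le) auto
    also have "\<dots> = real (residue_count (K * k) (dilate_shift k X 0)) / real (K * k)"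
      using residue_count_dilate[OF assms, of K X] by (simp add: mult.commute)
    also have "\<dots> \<le> real (residue_count K (dilate_shift k X 0)) / real K"
      using \<open>K > 0\<close> assms by (intro residue_ratio_mult)
    finally show "1 / real k * residue_density X
        \<le> real (residue_count K (dilate_shift k X 0)) / real K" .
  qed
qed

lemma residue_density_shift: "residue_density (dilate_shift 1 X h) = residue_density X"
  by (simp add: residue_density_def residue_count_shift del: One_nat_def)

lemma residue_count_le:
  assumes "K > 0"
  shows "residue_count K X \<le> K"
proof -
  have "(\<lambda>x. x mod int K) ` X \<subseteq> {0..<int K}"
    using assms by auto
  then have "card ((\<lambda>x. x mod int K) ` X) \<le> card {0..<int K}"
    by (intro card_mono) auto
  then show ?thesis
    by (simp add: residue_count_def)
qed

text \<open>The representatives \<open>0, ..., K - 1\<close> already lie in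
  \<open>H\<close>.\<close>

lemma residue_count_Nats_subset:
  assumes "K > 0" "\<nat> \<subseteq> H"
  shows "residue_count K H = K"
proof (rule antisym[OF residue_count_le[OF assms(1)]])
  have "{0..<int K} \<subseteq> (\<lambda>x. x mod int K) ` H"
  proof
    fix x assume x: "x \<in> {0..<int K}"
    then have "x \<in> H"
      using assms(2) by (auto simp: Nats_altdef1)
    then show "x \<in> (\<lambda>x. x mod int K) ` H"
      using x by (intro image_eqI[of _ _ x]) auto
  qed
  then have "card {0..<int K} \<le> card ((\<lambda>x. x mod int K) ` H)"
    by (intro card_mono finite_residues assms)
  then show "K \<le> residue_count K H"
    by (simp add: residue_count_def)
qed

lemma upper_quasi_density_residue_density:
  assumes "\<nat> \<subseteq> H"
  shows "upper_quasi_density H residue_density"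
proof -
  have le: "residue_density X \<le> 1" for X
    using residue_density_le[of 1 X] residue_count_le[of 1 X] by simp
  moreover have "residue_density H = 1"
    by (rule antisym[OF le], rule residue_density_ge)
       (simp add: residue_count_Nats_subset assms)
  ultimately show ?thesis
    by (simp add: upper_quasi_density_def residue_density_Un residue_density_dilate
        residue_density_shift del: One_nat_def)
qed

section \<open>Bounds valid for every upper quasi-density\<close>

text \<open>Nonnegativity is not an axiom; it follows from subadditivity applied to \<open>X\<close>
  and \<open>X\<close> itself.\<close>

lemma upper_quasi_density_nonneg:
  assumes "upper_quasi_density H \<mu>" "X \<subseteq> H"
  shows "\<mu> X \<ge> 0"
proof -
  have "\<mu> (X \<union> X) \<le> \<mu> X + \<mu> X"
    using assms by (simp only: upper_quasi_density_def)
  then show ?thesis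
    by simp
qed

text \<open>The empty set is its own dilate by 2, so its value equals half of itself.\<close>

lemma upper_quasi_density_empty:
  assumes "upper_quasi_density H \<mu>"
  shows "\<mu> {} = 0"
proof -
  have "\<mu> (dilate_shift 2 {} 0) = 1 / real 2 * \<mu> {}"
    using assms unfolding upper_quasi_density_def by (metis empty_subsetI zero_less_numeral)
  then show ?thesis
    by (simp add: dilate_shift_def)
qed

lemma upper_quasi_density_UN_le:
  assumes "upper_quasi_density H \<mu>" "finite I" "\<And>i. i \<in> I \<Longrightarrow> Z i \<subseteq> H"
  shows "\<mu> (\<Union>i\<in>I. Z i) \<le> (\<Sum>i\<in>I. \<mu> (Z i))"
  using assms(2,3)
proof (induction I rule: finite_induct)
  case empty
  then show ?case
    by (simp add: upper_quasi_density_empty[OF assms(1)])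
next
  case (insert i I)
  have "\<mu> (Z i \<union> (\<Union>i\<in>I. Z i)) \<le> \<mu> (Z i) + \<mu> (\<Union>i\<in>I. Z i)"
    using assms(1) insert.prems unfolding upper_quasi_density_def
    by (meson UN_least insertCI)
  then show ?case
    using insert by fastforce
qed

text \<open>The axioms treat dilation and translation separately; this factorization lets them be
  applied in turn.\<close>

lemma dilate_shift_eq: "dilate_shift k X h = dilate_shift 1 (dilate_shift k X 0) h"
  by (simp add: dilate_shift_def image_image)

text \<open>Dilation scales \<open>\<mu> X \<le> 1\<close> by \<open>1 / k\<close> and translation
  changes nothing. The third assumption puts the intermediate dilate in the scope of the translation
  axiom.\<close>

lemma upper_quasi_density_dilate_shift_le:
  assumes "upper_quasi_density H \<mu>" "X \<subseteq> H" "dilate_shift k X 0 \<subseteq> H" "k > 0"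
  shows "\<mu> (dilate_shift k X h) \<le> 1 / real k"
proof -
  have "\<mu> (dilate_shift k X h) = 1 / real k * \<mu> X"
    using assms by (subst dilate_shift_eq) (simp add: upper_quasi_density_def del: One_nat_def)
  also have "\<dots> \<le> 1 / real k * 1"
    using assms by (intro mult_left_mono) (auto simp: upper_quasi_density_def)
  finally show ?thesis
    by simp
qed

lemma div_mem_UNIV_or_Nats:
  fixes H :: "int set"
  assumes "H = UNIV \<or> H = \<nat>" "x \<in> H"
  shows "x div int K \<in> H"
  using assms by (auto simp: Nats_altdef1 div_int_pos_iff)

lemma dilate_shift_subset_UNIV_or_Nats:
  fixes H :: "int set"
  assumes "H = UNIV \<or> H = \<nat>" "X \<subseteq> H"
  shows "dilate_shift k X h \<subseteq> H"
  using assms by (auto simp: Nats_altdef1 dilate_shift_def)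

lemma upper_quasi_density_le_residue_ratio:
  assumes H: "H = UNIV \<or> H = \<nat>" and "X \<subseteq> H" and \<mu>: "upper_quasi_density H \<mu>" and "K > 0"
  shows "\<mu> X \<le> real (residue_count K X) / real K"
proof -
  define R where "R = (\<lambda>x. x mod int K) ` X"
  \<comment> \<open>The quotients of the elements of \<open>X\<close> in class \<open>r\<close>;
    since \<open>x = K * (x div K) + x mod K\<close>, that part of \<open>X\<close> is exactly
    \<open>K * Y r + r\<close>.\<close>
  define Y where "Y r = (\<lambda>x. x div int K) ` {x \<in> X. x mod int K = r}" for r
  have Y: "Y r \<subseteq> H" for r
    using assms(2) div_mem_UNIV_or_Nats[OF H] by (auto simp: Y_def)
  have split: "dilate_shift K (Y r) (nat r) = {x \<in> X. x mod int K = r}" if "r \<in> R" for r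
  proof -
    have "r \<ge> 0"
      using that \<open>K > 0\<close> by (auto simp: R_def)
    then show ?thesis
      by (force simp: dilate_shift_def Y_def image_image)
  qed
  \<comment> \<open>Equality is essential here: a mere cover of \<open>X\<close> would say nothing
    about \<open>\<mu> X\<close> without monotonicity.\<close>
  have "X = (\<Union>r\<in>R. dilate_shift K (Y r) (nat r))"
    using split by (auto simp: R_def)
  then have "\<mu> X = \<mu> (\<Union>r\<in>R. dilate_shift K (Y r) (nat r))"
    by simp
  also have "\<dots> \<le> (\<Sum>r\<in>R. \<mu> (dilate_shift K (Y r) (nat r)))"
    unfolding R_def
    by (intro upper_quasi_density_UN_le[OF \<mu>] finite_residues assms
        dilate_shift_subset_UNIV_or_Nats[OF H] Y)
  also have "\<dots> \<le> (\<Sum>r\<in>R. 1 / real K)"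
    by (intro sum_mono upper_quasi_density_dilate_shift_le[OF \<mu>] Y assms
        dilate_shift_subset_UNIV_or_Nats[OF H])
  also have "\<dots> = real (residue_count K X) / real K"
    by (simp add: R_def residue_count_def)
  finally show ?thesis .
qed

section \<open>Upper asymptotic density of sets closed under adding a period\<close>

text \<open>A bounded counting error \<open>C\<close> becomes \<open>C / n\<close> in the ratio, so
  the ratio converges and the limit superior is its limit.\<close>

lemma upper_asymptotic_density_eqI:
  assumes lower: "\<And>n::nat. c * real n - C \<le> real (card (A \<inter> {1..int n}))"
    and upper: "\<And>n::nat. real (card (A \<inter> {1..int n})) \<le> c * real n + C"
  shows "upper_asymptotic_density A = c"
proof -
  let ?f = "\<lambda>n. real (card (A \<inter> {1..int n})) / real n"
  have C0: "(\<lambda>n. C / real n) \<longlonglongrightarrow> 0"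
    by (rule lim_const_over_n)
  have "?f \<longlonglongrightarrow> c"
  proof (rule real_tendsto_sandwich)
    show "\<forall>\<^sub>F n in sequentially. c - C / real n \<le> ?f n"
      using eventually_gt_at_top[of 0]
    proof eventually_elim
      case (elim n)
      have "(c * real n - C) / real n \<le> ?f n"
        by (intro divide_right_mono lower) simp
      then show ?case
        using elim by (simp add: diff_divide_distrib)
    qed
    show "\<forall>\<^sub>F n in sequentially. ?f n \<le> c + C / real n"
      using eventually_gt_at_top[of 0]
    proof eventually_elim
      case (elim n)
      have "?f n \<le> (c * real n + C) / real n"
        by (intro divide_right_mono upper) simp
      then show ?case
        using elim by (simp add: add_divide_distrib)
    qed
    show "(\<lambda>n. c - C / real n) \<longlonglongrightarrow> c"
      using tendsto_diff[OF tendsto_const C0, of c] by simp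
    show "(\<lambda>n. c + C / real n) \<longlonglongrightarrow> c"
      using tendsto_add[OF tendsto_const C0, of c] by simp
  qed
  then have "(\<lambda>n. ereal (?f n)) \<longlonglongrightarrow> ereal c"
    by simp
  then have "limsup (\<lambda>n. ereal (?f n)) = ereal c"
    by (intro lim_imp_Limsup) auto
  then show ?thesis
    by (simp add: upper_asymptotic_density_def)
qed

text \<open>Remainder and quotient by \<open>K\<close> determine an element, and for elements of
  \<open>{1..n}\<close> the quotient takes at most \<open>n div K + 1\<close> values.\<close>

lemma card_le_residue_count:
  assumes "K > 0"
  shows "card (A \<inter> {1..int n}) \<le> residue_count K A * (n div K + 1)"
proof -
  let ?f = "\<lambda>x. (x mod int K, x div int K)"
  let ?S = "A \<inter> {1..int n}"
  let ?T = "((\<lambda>x. x mod int K) ` A) \<times> {0..int (n div K)}"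
  have "inj_on ?f ?S"
    by (rule inj_onI) (metis Pair_inject mult_div_mod_eq)
  moreover have "?f ` ?S \<subseteq> ?T"
    using assms by (auto simp: zdiv_int pos_imp_zdiv_nonneg_iff intro!: zdiv_mono1)
  ultimately have "card ?S \<le> card ?T"
    using finite_residues[OF assms] by (intro card_inj_on_le) auto
  then show ?thesis
    by (simp add: residue_count_def card_cartesian_product nat_add_distrib add.commute)
qed

lemma closed_add_multiples:
  fixes A :: "int set"
  assumes "\<And>x. x \<in> A \<Longrightarrow> x + k \<in> A" "x \<in> A"
  shows "x + k * int j \<in> A"
proof (induction j)
  case 0
  then show ?case using assms(2) by simp
next
  case (Suc j)
  then have "x + k * int j + k \<in> A"
    by (rule assms(1))
  then show ?case
    by (simp add: algebra_simps)
qed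

text \<open>Every class met by \<open>A\<close> contains a positive \<open>a r\<close> in
  \<open>A\<close>, and the translates \<open>a r + K * j\<close> with \<open>j < m\<close> stay in
  \<open>A\<close>. Closure is only upwards, so a class may start late; the offset \<open>M\<close>,
  independent of \<open>m\<close>, absorbs this.\<close>

lemma residue_count_le_card:
  assumes "K > 0" and closed: "\<And>x. x \<in> A \<Longrightarrow> x + int K \<in> A"
  obtains M where "\<And>m. residue_count K A * m \<le> card (A \<inter> {1..int (M + K * m)})"
proof -
  let ?R = "(\<lambda>x. x mod int K) ` A"
  have fin: "finite ?R"
    by (rule finite_residues[OF assms(1)])
  have "\<exists>a. a \<in> A \<and> a \<ge> 1 \<and> a mod int K = r" if "r \<in> ?R" for r
  proof -
    from that obtain x where x: "x \<in> A" "x mod int K = r"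
      by blast
    \<comment> \<open>Adding \<open>K\<close> exactly \<open>\<bar>x\<bar> + 1\<close> times is
      enough to make any \<open>x\<close> positive.\<close>
    have "\<bar>x\<bar> + 1 \<le> int K * (\<bar>x\<bar> + 1)"
      using assms(1) mult_right_mono[of 1 "int K" "\<bar>x\<bar> + 1"] by simp
    then have "x + int K * (\<bar>x\<bar> + 1) \<ge> 1"
      by linarith
    then have "x + int K * int (nat (\<bar>x\<bar> + 1)) \<ge> 1"
      by simp
    moreover have "x + int K * int (nat (\<bar>x\<bar> + 1)) \<in> A"
      using closed_add_multiples[of A "int K"] closed x(1) by blast
    moreover have "(x + int K * int (nat (\<bar>x\<bar> + 1))) mod int K = r"
      using x(2) by (metis mod_mult_self2)
    ultimately show ?thesis
      by blast
  qed
  then obtain a where a: "\<And>r. r \<in> ?R \<Longrightarrow> a r \<in> A \<and> a r \<ge> 1 \<and> a r mod int K = r"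
    by metis
  \<comment> \<open>The sum is a crude common bound for all \<open>a r\<close>; unlike a maximum it
    also makes sense when \<open>A\<close> is empty.\<close>
  define M where "M = (\<Sum>r\<in>?R. nat (a r))"
  have aM: "a r \<le> int M" if "r \<in> ?R" for r
  proof -
    have "nat (a r) \<le> M"
      unfolding M_def by (rule member_le_sum[OF that _ fin]) simp
    then show ?thesis
      by simp
  qed
  have "residue_count K A * m \<le> card (A \<inter> {1..int (M + K * m)})" for m
  proof -
    let ?g = "\<lambda>(r, j). a r + int K * int j"
    have "inj_on ?g (?R \<times> {..<m})"
    proof (rule inj_onI)
      fix p q assume p: "p \<in> ?R \<times> {..<m}" and q: "q \<in> ?R \<times> {..<m}" and eq: "?g p = ?g q"
      obtain r i s j where pq: "p = (r, i)" "q = (s, j)"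
        by (metis surj_pair)
      have "r \<in> ?R" "s \<in> ?R"
        using p q pq by auto
      \<comment> \<open>Reduction mod \<open>K\<close> recovers the class, after which the index is
        recovered by cancellation.\<close>
      have "(a r + int K * int i) mod int K = (a s + int K * int j) mod int K"
        using eq pq by simp
      then have "r = s"
        using a[OF \<open>r \<in> ?R\<close>] a[OF \<open>s \<in> ?R\<close>] by simp
      then show "p = q"
        using eq pq assms(1) by simp
    qed
    moreover have "?g ` (?R \<times> {..<m}) \<subseteq> A \<inter> {1..int (M + K * m)}"
    proof (rule image_subsetI)
      fix p assume "p \<in> ?R \<times> {..<m}"
      then obtain r j where p: "p = (r, j)" "r \<in> ?R" "j < m"
        by blast
      have "int K * int j \<le> int K * int m"
        using p(3) by (intro mult_left_mono) auto
      moreover have "0 \<le> int K * int j"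
        by simp
      moreover have "a r + int K * int j \<in> A"
        using closed_add_multiples[of A "int K"] closed a[OF p(2)] by blast
      ultimately show "?g p \<in> A \<inter> {1..int (M + K * m)}"
        using a[OF p(2)] aM[OF p(2)] p(1) by (auto intro: add_increasing2)
    qed
    ultimately have "card (?R \<times> {..<m}) \<le> card (A \<inter> {1..int (M + K * m)})"
      by (intro card_inj_on_le) auto
    then show ?thesis
      by (simp add: residue_count_def card_cartesian_product)
  qed
  then show thesis
    by (rule that)
qed

lemma upper_asymptotic_density_closed:
  assumes "K > 0" and closed: "\<And>x. x \<in> A \<Longrightarrow> x + int K \<in> A"
  shows "upper_asymptotic_density A = real (residue_count K A) / real K"
proof -
  define r where "r = residue_count K A"
  obtain M where M: "\<And>m. r * m \<le> card (A \<inter> {1..int (M + K * m)})"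
    using residue_count_le_card[OF assms] unfolding r_def by blast
  \<comment> \<open>The term \<open>r * M / K\<close> pays for the offset \<open>M\<close>, and the
    remaining \<open>r\<close> for rounding in the division by \<open>K\<close>.\<close>
  define C where "C = real r * (real M / real K + 1)"
  have "real r \<le> C"
    by (simp add: C_def algebra_simps)
  have "upper_asymptotic_density A = real r / real K"
  proof (rule upper_asymptotic_density_eqI)
    fix n :: nat
    have "real (card (A \<inter> {1..int n})) \<le> real (r * (n div K + 1))"
      unfolding r_def by (intro of_nat_mono card_le_residue_count assms)
    also have "\<dots> = real r * real (n div K) + real r"
      by (simp add: algebra_simps)
    also have "\<dots> \<le> real r * (real n / real K) + C"
      by (intro add_mono mult_left_mono of_nat_div_le_of_nat \<open>real r \<le> C\<close>) auto
    finally show "real (card (A \<inter> {1..int n})) \<le> real r / real K * real n + C"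
      by simp
    show "real r / real K * real n - C \<le> real (card (A \<inter> {1..int n}))"
    proof (cases "M \<le> n")
      case True
      \<comment> \<open>The largest \<open>m\<close> with \<open>M + K * m \<le> n\<close>.\<close>
      define m where "m = (n - M) div K"
      have "real m = real_of_int (int (n - M) div int K)"
        by (simp add: m_def flip: zdiv_int)
      then have "(real n - real M) / real K - 1 \<le> real m"
        using real_of_int_div3[of "int (n - M)" "int K"] True by simp
      then have "real r * ((real n - real M) / real K - 1) \<le> real r * real m"
        by (intro mult_left_mono) auto
      then have "real r / real K * real n - C \<le> real (r * m)"
        by (simp add: C_def diff_divide_distrib algebra_simps)
      also have "\<dots> \<le> real (card (A \<inter> {1..int (M + K * m)}))"
        by (intro of_nat_mono M)
      also have "\<dots> \<le> real (card (A \<inter> {1..int n}))"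
      proof -
        have "K * m \<le> n - M"
          by (simp add: m_def)
        then have "M + K * m \<le> n"
          using True by simp
        then have "int (M + K * m) \<le> int n"
          by (rule of_nat_mono)
        then show ?thesis
          by (intro of_nat_mono card_mono) auto
      qed
      finally show ?thesis .
    next
      case False
      \<comment> \<open>For \<open>n < M\<close> the claimed lower bound is at most 0.\<close>
      then have "real r * (real n / real K) \<le> real r * (real M / real K)"
        by (intro mult_left_mono divide_right_mono) auto
      also have "\<dots> \<le> C"
        by (simp add: C_def algebra_simps)
      finally show ?thesis
        by simp
    qed
  qed
  then show ?thesis
    by (simp add: r_def)
qed

section \<open>Finite unions of arithmetic progressions and the upper Buck density\<close>

text \<open>Periodicity is stated forwards only, because a progression of \<open>\<nat>\<close> has
  a first element.\<close>

lemma dilate_shift_closed: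
  fixes H :: "int set"
  assumes "H = UNIV \<or> H = \<nat>" "x \<in> dilate_shift k H h"
  shows "x + int k \<in> dilate_shift k H h"
proof -
  obtain y where y: "y \<in> H" "x = int k * y + int h"
    using assms(2) by (auto simp: dilate_shift_def)
  have "y + 1 \<in> H"
    using assms(1) y(1) by auto
  then show ?thesis
    unfolding dilate_shift_def using y(2)
    by (intro image_eqI[of _ _ "y + 1"]) (auto simp: algebra_simps)
qed

lemma finite_APs_common_period:
  fixes H :: "int set"
  assumes "H = UNIV \<or> H = \<nat>" "finite \<F>" "\<F> \<subseteq> arith_progressions H"
  shows "\<exists>K>0. \<forall>D\<in>\<F>. \<forall>x\<in>D. x + int K \<in> D"
  using assms(2,3)
proof (induction \<F> rule: finite_induct)
  case empty
  then show ?case by auto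
next
  case (insert D \<F>)
  then obtain K where K: "K > 0" "\<And>E x. E \<in> \<F> \<Longrightarrow> x \<in> E \<Longrightarrow> x + int K \<in> E"
    by auto
  obtain k h where k: "k > 0" "D = dilate_shift k H h"
    using insert.prems by (auto simp: arith_progressions_def)
  \<comment> \<open>The product serves as common period: adding it is \<open>K\<close> steps of
    length \<open>k\<close> in \<open>D\<close>, and \<open>k\<close> steps of length
    \<open>K\<close> in the other progressions.\<close>
  have "x + int (K * k) \<in> E" if "E \<in> insert D \<F>" "x \<in> E" for E x
  proof (cases "E = D")
    case True
    then show ?thesis
      using closed_add_multiples[of D "int k" x K] dilate_shift_closed[OF assms(1)] that k(2)
      by (simp add: mult.commute)
  next
    case False
    then show ?thesis
      using closed_add_multiples[of E "int K" x k] K(2) that by simp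
  qed
  then show ?case
    using K(1) k(1) by (intro exI[of _ "K * k"]) auto
qed

text \<open>Covering \<open>X\<close> by the progressions \<open>K * H + r\<close>, for the residues
  \<open>r\<close> of \<open>X\<close>, adds no new residue class. Hence each ratio of
  \<open>X\<close> is the density of an admissible cover.\<close>

lemma AP_cover_residues:
  fixes H X :: "int set"
  assumes H: "H = UNIV \<or> H = \<nat>" and "X \<subseteq> H" "K > 0"
  obtains A where "A \<in> finite_AP_unions H" "X \<subseteq> A"
    "upper_asymptotic_density A = real (residue_count K X) / real K"
proof -
  let ?R = "(\<lambda>x. x mod int K) ` X"
  define A where "A = (\<Union>r\<in>?R. dilate_shift K H (nat r))"
  have nonneg: "x mod int K \<ge> 0" for x
    using \<open>K > 0\<close> by simp
  have "(\<lambda>r. dilate_shift K H (nat r)) ` ?R \<subseteq> arith_progressions H"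
    using \<open>K > 0\<close> by (auto simp: arith_progressions_def)
  moreover have "finite ((\<lambda>r. dilate_shift K H (nat r)) ` ?R)"
    by (intro finite_imageI finite_residues assms)
  ultimately have mem: "A \<in> finite_AP_unions H"
    unfolding finite_AP_unions_def A_def by blast
  have sub: "X \<subseteq> A"
  proof
    fix x assume "x \<in> X"
    have "x div int K \<in> H"
      using div_mem_UNIV_or_Nats[OF H] \<open>x \<in> X\<close> assms(2) by blast
    then have "x \<in> dilate_shift K H (nat (x mod int K))"
      unfolding dilate_shift_def using nonneg
      by (intro image_eqI[of _ _ "x div int K"]) auto
    then show "x \<in> A"
      using \<open>x \<in> X\<close> by (auto simp: A_def)
  qed
  have "(\<lambda>x. x mod int K) ` A \<subseteq> ?R"
    using nonneg by (auto simp: A_def dilate_shift_def)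
  then have "residue_count K A = residue_count K X"
    using sub unfolding residue_count_def by (metis image_mono subset_antisym)
  moreover have "upper_asymptotic_density A = real (residue_count K A) / real K"
    by (rule upper_asymptotic_density_closed[OF \<open>K > 0\<close>])
       (use dilate_shift_closed[OF H] in \<open>auto simp: A_def\<close>)
  ultimately show thesis
    using that mem sub by simp
qed

text \<open>At a common period \<open>K\<close> of the progressions forming \<open>A\<close>, the
  density of \<open>A\<close> is its residue ratio, which dominates that of
  \<open>X\<close>.\<close>

lemma residue_density_le_upper_asymptotic_density:
  fixes H X :: "int set"
  assumes "H = UNIV \<or> H = \<nat>" "A \<in> finite_AP_unions H" "X \<subseteq> A"
  shows "residue_density X \<le> upper_asymptotic_density A"
proof -
  obtain \<F> where F: "A = \<Union>\<F>" "finite \<F>" "\<F> \<subseteq> arith_progressions H"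
    using assms(2) by (auto simp: finite_AP_unions_def)
  obtain K where K: "K > 0" "\<forall>D\<in>\<F>. \<forall>x\<in>D. x + int K \<in> D"
    using finite_APs_common_period[OF assms(1) F(2,3)] by blast
  have "residue_density X \<le> real (residue_count K X) / real K"
    by (rule residue_density_le[OF K(1)])
  also have "\<dots> \<le> real (residue_count K A) / real K"
    by (intro divide_right_mono of_nat_mono residue_count_mono assms K) simp
  also have "\<dots> = upper_asymptotic_density A"
    by (rule upper_asymptotic_density_closed[symmetric, OF K(1)]) (use K(2) F(1) in auto)
  finally show ?thesis .
qed

text \<open>The ratios of \<open>X\<close> occur among the densities of covers, and
  \<open>residue_density X\<close> bounds all these densities from below. The right-hand side does
  not mention \<open>H\<close>, which is what links the two ambient sets.\<close>

lemma upper_Buck_density_eq_residue_density: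
  fixes H X :: "int set"
  assumes H: "H = UNIV \<or> H = \<nat>" and "X \<subseteq> H"
  shows "upper_Buck_density H X = residue_density X"
proof (rule antisym)
  let ?S = "{upper_asymptotic_density A | A. A \<in> finite_AP_unions H \<and> X \<subseteq> A}"
  have lower: "residue_density X \<le> d" if "d \<in> ?S" for d
    using that residue_density_le_upper_asymptotic_density[OF H] by blast
  then have bdd: "bdd_below ?S"
    by (rule bdd_belowI)
  have ratio: "real (residue_count K X) / real K \<in> ?S" if "K > 0" for K
  proof -
    obtain A where "A \<in> finite_AP_unions H" "X \<subseteq> A"
      "upper_asymptotic_density A = real (residue_count K X) / real K"
      using AP_cover_residues[OF assms \<open>K > 0\<close>] .
    then show ?thesis
      by (intro CollectI exI[of _ A]) simp
  qed
  \<comment> \<open>The modulus 1 provides a member; a greatest lower bound argument for real infima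
    requires one.\<close>
  have "?S \<noteq> {}"
    using ratio[of 1] by (metis empty_iff zero_less_one)
  show "upper_Buck_density H X \<le> residue_density X"
    unfolding upper_Buck_density_def
    by (rule residue_density_ge, rule cInf_lower[OF ratio bdd])
  show "residue_density X \<le> upper_Buck_density H X"
    unfolding upper_Buck_density_def
    by (rule cInf_greatest[OF \<open>?S \<noteq> {}\<close> lower])
qed

section \<open>Smallness and the equivalences\<close>

text \<open>Forwards, smallness is tested on \<open>residue_density\<close> itself. Backwards, any
  \<open>\<mu> X\<close> is at least 0 and at most every residue ratio of \<open>X\<close>, hence at
  most their infimum 0.\<close>

lemma small_iff_residue_density:
  fixes H X :: "int set"
  assumes H: "H = UNIV \<or> H = \<nat>" and "X \<subseteq> H"
  shows "small H X \<longleftrightarrow> residue_density X = 0"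
proof
  assume "small H X"
  then show "residue_density X = 0"
    using upper_quasi_density_residue_density[of H] H by (auto simp: small_def)
next
  assume zero: "residue_density X = 0"
  have "\<mu> X = 0" if "upper_quasi_density H \<mu>" for \<mu>
  proof (rule antisym)
    show "\<mu> X \<le> 0"
      using residue_density_ge[OF upper_quasi_density_le_residue_ratio[OF assms that]] zero by simp
    show "0 \<le> \<mu> X"
      by (rule upper_quasi_density_nonneg[OF that assms(2)])
  qed
  then show "small H X"
    using assms(2) by (simp add: small_def)
qed

theorem theorem2p4:
  fixes H X :: "int set"
  assumes "H = UNIV \<or> H = \<nat>"
    and "X \<subseteq> H"
  shows "(small H X \<longleftrightarrow> upper_Buck_density H X = 0) \<and>
         (upper_Buck_density H X = 0 \<longleftrightarrow> upper_Buck_density UNIV X = 0)"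
  using small_iff_residue_density[OF assms] upper_Buck_density_eq_residue_density[OF assms]
    upper_Buck_density_eq_residue_density[of UNIV X]
  by simp

end
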